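(* Let $Q$ and $R$ be inverse quantal frames and $X$ a $Q$-$R$-bisheaf satisfying \[ \bigvee_{s\in\Gamma^{\mathrm{bi}}_X}\langle s,s\rangle=e_Q\qquad\text{and}\qquad\bigvee_{s\in\Gamma^{\mathrm{bi}}_X}[s,s]=e_R. \] Then $X$ is a biprincipal $Q$-$R$-bisheaf if and only if for all $s,t,u\in\Gamma^{\mathrm{bi}}_X$ we have \[ \langle s,t\rangle u=s[t,u]. \]
   Context: A unital involutive quantale $Q$ is a complete lattice with an associative multiplication preserving arbitrary joins in each variable, unit $e_Q$, and a join-preserving involution with $a^{**}=a$, $(ab)^*=b^*a^*$. Put $Q_0={\downarrow}e_Q$ and $Q_{\mathcal I}=\{s\in Q:ss^*\vee s^*s\le e_Q\}$. An inverse quantal frame is a unital involutive quantale which is a locale (binary meets distribute over joins), with $\bigvee Q_{\mathcal I}=1_Q$, and with a (unique) stable support: a join-preserving $\varsigma_Q:Q\to Q_0$ with $\varsigma_Q(a)\le aa^*$, $a\le\varsigma_Q(a)a$, $\varsigma_Q(ab)\le\varsigma_Q(a)$. Top elements are denoted $1$. A left $Q$-locale is a locale $X$ with a unital associative left action of $Q$ preserving joins in each variable, with $bx=b1_X\wedge x$ for $b\in Q_0$. It is a $Q$-sheaf if there is a (necessarily unique) monotone $Q_0$-equivariant $\varsigma_X:X\to Q_0$ with $\varsigma_X(x)x=x$ for all $x$, and $\bigvee\Gamma_X=1_X$, where $\Gamma_X$ (local sections) is the set of $s\in X$ with $\varsigma_X(x)s=x$ for all $x\le s$. A $Q$-sheaf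 has a canonical inner product $\langle-,-\rangle:X\times X\to Q$, the unique map preserving joins in each variable with, for $s,t\in\Gamma_X$, $\langle s,t\rangle=\bigvee\{v\in Q_{\mathcal I}:\varsigma_Q(v)\le\varsigma_X(s),\varsigma_Q(v^* )\le\varsigma_X(t),vt\le s\}$; it satisfies $\langle ax,y\rangle=a\langle x,y\rangle$, $\langle x,y\rangle^*=\langle y,x\rangle$, $\varsigma_X(x)=\langle x,x\rangle\wedge e_Q$. A principal section is $s\in\Gamma_X$ with $\langle s,s\rangle\le e_Q$. Right $R$-sheaves are defined symmetrically (equivalently, via the left action $r\cdot x=xr^*$), with support $\tau:X\to R_0$ and inner product $[-,-]:X\times X\to R$ (the canonical inner product of the left $R$-sheaf with action $r\cdot x=xr^*$), so $[x,yr]=[x,y]r$ and $\tau(x)=[x,x]\wedge e_R$. A $Q$-$R$-bisheaf is a $Q$-$R$-bimodule $X$ (commuting unital left and right actions) that is a left $Q$-sheaf and a right $R$-sheaf. Its local bisections are the elements of $\Gamma^{\mathrm{bi}}_X=\Gamma_X\cap\Gamma_X^\tau$, where $\Gamma_X^\tau$ is the set of $s\in X$ with $s\tau(x)=x$ for all $x\le s$. The dual $X^*$ is $X$ regarded as an $R$-$Q$-bisheaf by $r\cdot x=xr^*$, $x\cdot a=a^*x$. A $Q$-$R$-bisheaf $X$ is principal if the join of its principal sections (as a $Q$-sheaf) is $1_X$ and $c\mapsto1_Xc$ is an isomorphism from $R_0$ onto $I(X)=\{x\in X:1_Qx=x\}$. It is biprincipal if $X$ is a principal $Q$-$R$-bisheaf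 and $X^*$ is a principal $R$-$Q$-bisheaf. *)

theory Defs
  imports Main
begin

section \<open>Locales (frames) and inverse quantal frames\<close>

text \<open>The existing class \<^class>\<open>complete_distrib_lattice\<close> asserts complete distributivity,
  which is strictly stronger than the frame law.\<close>

class frame = complete_lattice +
  assumes inf_Sup_frame: "inf a (Sup B) = (SUP b\<in>B. inf a b)"

class unital_involutive_quantale = complete_lattice + monoid_mult +
  fixes invol :: "'a \<Rightarrow> 'a"  (\<open>(_\<^sup>\<star>)\<close> [1000] 999)
  assumes mult_Sup: "a * Sup B = (SUP b\<in>B. a * b)"
    and Sup_mult: "Sup B * a = (SUP b\<in>B. b * a)"
    and invol_Sup: "(Sup B)\<^sup>\<star> = (SUP b\<in>B. b\<^sup>\<star>)"
    and invol_invol: "(a\<^sup>\<star>)\<^sup>\<star> = a"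
    and invol_mult: "(a * b)\<^sup>\<star> = b\<^sup>\<star> * a\<^sup>\<star>"

text \<open>The unit $e_Q$ is \<^term>\<open>1\<close>; the top element $1_Q$ is \<^term>\<open>top\<close>.\<close>

definition base :: "'q::unital_involutive_quantale set"
  where "base = {b. b \<le> 1}"

definition partial_units :: "'q::unital_involutive_quantale set"
  where "partial_units = {s. sup (s * s\<^sup>\<star>) (s\<^sup>\<star> * s) \<le> 1}"

text \<open>A stable support is unique if it exists, hence it may be taken as part of the structure.\<close>

class inverse_quantal_frame = unital_involutive_quantale + frame +
  fixes qsupp :: "'a \<Rightarrow> 'a"
  assumes Sup_partial_units: "Sup {s. sup (s * s\<^sup>\<star>) (s\<^sup>\<star> * s) \<le> 1} = top"
    and qsupp_le_one: "qsupp a \<le> 1"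
    and qsupp_Sup: "qsupp (Sup A) = (SUP a\<in>A. qsupp a)"
    and qsupp_le: "qsupp a \<le> a * a\<^sup>\<star>"
    and le_qsupp_mult: "a \<le> qsupp a * a"
    and qsupp_mult_le: "qsupp (a * b) \<le> qsupp a"


section \<open>Sheaves\<close>

definition left_module ::
    "('q::unital_involutive_quantale \<Rightarrow> 'x::complete_lattice \<Rightarrow> 'x) \<Rightarrow> bool" where
  "left_module act \<longleftrightarrow>
     (\<forall>x. act 1 x = x) \<and>
     (\<forall>a b x. act (a * b) x = act a (act b x)) \<and>
     (\<forall>A x. act (Sup A) x = (SUP a\<in>A. act a x)) \<and>
     (\<forall>a Y. act a (Sup Y) = (SUP y\<in>Y. act a y))"

definition left_locale ::
    "('q::inverse_quantal_frame \<Rightarrow> 'x::frame \<Rightarrow> 'x) \<Rightarrow> bool" where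
  "left_locale act \<longleftrightarrow>
     left_module act \<and> (\<forall>b\<in>base. \<forall>x. act b x = inf (act b top) x)"

definition is_support ::
    "('q::inverse_quantal_frame \<Rightarrow> 'x::frame \<Rightarrow> 'x) \<Rightarrow> ('x \<Rightarrow> 'q) \<Rightarrow> bool" where
  "is_support act \<sigma> \<longleftrightarrow>
     (\<forall>x. \<sigma> x \<in> base) \<and> mono \<sigma> \<and>
     (\<forall>b\<in>base. \<forall>x. \<sigma> (act b x) = b * \<sigma> x) \<and>
     (\<forall>x. act (\<sigma> x) x = x)"

definition supp :: "('q::inverse_quantal_frame \<Rightarrow> 'x::frame \<Rightarrow> 'x) \<Rightarrow> 'x \<Rightarrow> 'q"
  where "supp act = (THE \<sigma>. is_support act \<sigma>)"

definition sections :: "('q::inverse_quantal_frame \<Rightarrow> 'x::frame \<Rightarrow> 'x) \<Rightarrow> 'x set"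
  where "sections act = {s. \<forall>x\<le>s. act (supp act x) s = x}"

definition left_sheaf :: "('q::inverse_quantal_frame \<Rightarrow> 'x::frame \<Rightarrow> 'x) \<Rightarrow> bool" where
  "left_sheaf act \<longleftrightarrow>
     left_locale act \<and> (\<exists>\<sigma>. is_support act \<sigma>) \<and> Sup (sections act) = top"

definition is_inner ::
    "('q::inverse_quantal_frame \<Rightarrow> 'x::frame \<Rightarrow> 'x) \<Rightarrow> ('x \<Rightarrow> 'x \<Rightarrow> 'q) \<Rightarrow> bool" where
  "is_inner act p \<longleftrightarrow>
     (\<forall>A y. p (Sup A) y = (SUP x\<in>A. p x y)) \<and>
     (\<forall>x B. p x (Sup B) = (SUP y\<in>B. p x y)) \<and>
     (\<forall>s\<in>sections act. \<forall>t\<in>sections act.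
        p s t = Sup {v \<in> partial_units.
                  qsupp v \<le> supp act s \<and> qsupp (v\<^sup>\<star>) \<le> supp act t \<and> act v t \<le> s})"

definition inner :: "('q::inverse_quantal_frame \<Rightarrow> 'x::frame \<Rightarrow> 'x) \<Rightarrow> 'x \<Rightarrow> 'x \<Rightarrow> 'q"
  where "inner act = (THE p. is_inner act p)"

definition principal_sections :: "('q::inverse_quantal_frame \<Rightarrow> 'x::frame \<Rightarrow> 'x) \<Rightarrow> 'x set"
  where "principal_sections act = {s \<in> sections act. inner act s s \<le> 1}"


section \<open>Bisheaves\<close>

text \<open>A right action is turned into a left action, and conversely, by means of the involution.
  Right sheaves and their supports and inner products are those of the resulting left action.\<close>

definition left_dual ::
    "('x \<Rightarrow> 'r::unital_involutive_quantale \<Rightarrow> 'x) \<Rightarrow> 'r \<Rightarrow> 'x \<Rightarrow> 'x"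
  where "left_dual ract = (\<lambda>r x. ract x (r\<^sup>\<star>))"

definition right_dual ::
    "('q::unital_involutive_quantale \<Rightarrow> 'x \<Rightarrow> 'x) \<Rightarrow> 'x \<Rightarrow> 'q \<Rightarrow> 'x"
  where "right_dual lact = (\<lambda>x a. lact (a\<^sup>\<star>) x)"

definition right_sheaf :: "('x::frame \<Rightarrow> 'r::inverse_quantal_frame \<Rightarrow> 'x) \<Rightarrow> bool"
  where "right_sheaf ract \<longleftrightarrow> left_sheaf (left_dual ract)"

definition right_supp :: "('x::frame \<Rightarrow> 'r::inverse_quantal_frame \<Rightarrow> 'x) \<Rightarrow> 'x \<Rightarrow> 'r"
  where "right_supp ract = supp (left_dual ract)"

definition right_inner :: "('x::frame \<Rightarrow> 'r::inverse_quantal_frame \<Rightarrow> 'x) \<Rightarrow> 'x \<Rightarrow> 'x \<Rightarrow> 'r"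
  where "right_inner ract = inner (left_dual ract)"

definition right_sections :: "('x::frame \<Rightarrow> 'r::inverse_quantal_frame \<Rightarrow> 'x) \<Rightarrow> 'x set"
  where "right_sections ract = {s. \<forall>x\<le>s. ract s (right_supp ract x) = x}"

definition bisheaf ::
    "('q::inverse_quantal_frame \<Rightarrow> 'x::frame \<Rightarrow> 'x) \<Rightarrow>
     ('x \<Rightarrow> 'r::inverse_quantal_frame \<Rightarrow> 'x) \<Rightarrow> bool" where
  "bisheaf lact ract \<longleftrightarrow>
     left_sheaf lact \<and> right_sheaf ract \<and>
     (\<forall>a x r. ract (lact a x) r = lact a (ract x r))"

definition bisections ::
    "('q::inverse_quantal_frame \<Rightarrow> 'x::frame \<Rightarrow> 'x) \<Rightarrow>
     ('x \<Rightarrow> 'r::inverse_quantal_frame \<Rightarrow> 'x) \<Rightarrow> 'x set"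
  where "bisections lact ract = sections lact \<inter> right_sections ract"

definition invariants :: "('q::inverse_quantal_frame \<Rightarrow> 'x::frame \<Rightarrow> 'x) \<Rightarrow> 'x set"
  where "invariants lact = {x. lact top x = x}"

text \<open>The set \<^const>\<open>invariants\<close> carries the order induced from the ambient locale; a bijection
  of locales is an isomorphism if and only if it preserves and reflects the order.\<close>

definition principal_bisheaf ::
    "('q::inverse_quantal_frame \<Rightarrow> 'x::frame \<Rightarrow> 'x) \<Rightarrow>
     ('x \<Rightarrow> 'r::inverse_quantal_frame \<Rightarrow> 'x) \<Rightarrow> bool" where
  "principal_bisheaf lact ract \<longleftrightarrow>
     bisheaf lact ract \<and>
     Sup (principal_sections lact) = top \<and>
     bij_betw (\<lambda>c. ract top c) base (invariants lact) \<and>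
     (\<forall>c\<in>base. \<forall>d\<in>base. ract top c \<le> ract top d \<longleftrightarrow> c \<le> d)"

definition biprincipal_bisheaf ::
    "('q::inverse_quantal_frame \<Rightarrow> 'x::frame \<Rightarrow> 'x) \<Rightarrow>
     ('x \<Rightarrow> 'r::inverse_quantal_frame \<Rightarrow> 'x) \<Rightarrow> bool" where
  "biprincipal_bisheaf lact ract \<longleftrightarrow>
     principal_bisheaf lact ract \<and>
     principal_bisheaf (left_dual ract) (right_dual lact)"


section \<open>Well-definedness of supports and inner products\<close>

context unital_involutive_quantale
begin

lemma mult_mono_q: "a \<le> b \<Longrightarrow> c \<le> d \<Longrightarrow> a * c \<le> b * d"
proof -
  assume "a \<le> b" "c \<le> d"
  have "a * c \<le> Sup {a, b} * c" unfolding Sup_mult by (rule SUP_upper) simp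
  also have "\<dots> = b * c" using \<open>a \<le> b\<close> by (simp add: sup.absorb2)
  also have "\<dots> \<le> b * Sup {c, d}" unfolding mult_Sup by (rule SUP_upper) simp
  also have "\<dots> = b * d" using \<open>c \<le> d\<close> by (simp add: sup.absorb2)
  finally show ?thesis .
qed

lemma invol_mono: "a \<le> b \<Longrightarrow> a\<^sup>\<star> \<le> b\<^sup>\<star>"
proof -
  assume "a \<le> b"
  have "a\<^sup>\<star> \<le> (Sup {a, b})\<^sup>\<star>" unfolding invol_Sup by (rule SUP_upper) simp
  also have "\<dots> = b\<^sup>\<star>" using \<open>a \<le> b\<close> by (simp add: sup.absorb2)
  finally show ?thesis .
qed

lemma invol_one: "1\<^sup>\<star> = 1"
  by (metis invol_invol invol_mult mult_1_left mult_1_right)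

end

context inverse_quantal_frame
begin

lemma base_invol: assumes "b \<le> 1" shows "b\<^sup>\<star> = b" and "qsupp b = b"
proof -
  have 1: "b\<^sup>\<star> \<le> 1" using invol_mono[OF assms] by (simp add: invol_one)
  have 2: "b \<le> qsupp b" if "b \<le> 1" for b
    using le_qsupp_mult[of b] mult_mono_q[OF order_refl that, of "qsupp b"]
    by (metis mult_1_right order_trans)
  have 3: "b \<le> b\<^sup>\<star>" if "b \<le> 1" for b
    using 2[OF that] qsupp_le[of b] mult_mono_q[OF that order_refl, of "b\<^sup>\<star>"]
    by (metis mult_1_left order_trans)
  show "b\<^sup>\<star> = b" using 3[OF assms] 3[OF 1] by (simp add: invol_invol)
  have "qsupp b \<le> b * 1" using qsupp_le[of b] mult_mono_q[OF order_refl 1, of b] by (rule order_trans)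
  then show "qsupp b = b" using 2[OF assms] by simp
qed

lemma mult_qsupp_invol: "a * qsupp (a\<^sup>\<star>) = a"
proof -
  have "qsupp (a\<^sup>\<star>) * a\<^sup>\<star> = a\<^sup>\<star>"
    using le_qsupp_mult mult_mono_q[OF qsupp_le_one order_refl, of "a\<^sup>\<star>" "a\<^sup>\<star>"]
    by (auto intro: order.antisym)
  then have "a * (qsupp (a\<^sup>\<star>))\<^sup>\<star> = a" by (metis invol_invol invol_mult)
  then show ?thesis by (simp add: base_invol(1) qsupp_le_one)
qed

end

lemma partial_units_base_mult:
  fixes v :: "'q::inverse_quantal_frame"
  assumes "v \<in> partial_units" "b \<le> 1"
  shows "b * v \<in> partial_units" and "v * b \<in> partial_units"
proof -
  have vv: "v * v\<^sup>\<star> \<le> 1" "v\<^sup>\<star> * v \<le> 1" using assms(1) by (auto simp: partial_units_def)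
  have bb: "b\<^sup>\<star> = b" by (rule base_invol(1)[OF assms(2)])
  have bb1: "b * b \<le> 1" using mult_mono_q[OF assms(2) assms(2)] by simp
  have A: "c * (b * b) * d \<le> 1" if "c * d \<le> 1" for c d
    using mult_mono_q[OF mult_mono_q[OF order_refl bb1] order_refl, of c d] that
    by (simp add: order_trans)
  have B: "b * w * b \<le> 1" if "w \<le> 1" for w
    using mult_mono_q[OF mult_mono_q[OF assms(2) that] assms(2)] by simp
  show "b * v \<in> partial_units" "v * b \<in> partial_units"
    using A[OF vv(1)] A[OF vv(2)] B[OF vv(1)] B[OF vv(2)]
    by (auto simp: partial_units_def invol_mult bb mult.assoc)
qed

lemma support_unique:
  assumes "is_support act \<sigma>" "is_support act \<sigma>'"
  shows "\<sigma> = \<sigma>'"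
proof -
  have *: "\<sigma>' x \<le> \<sigma> x" if "is_support act \<sigma>" "is_support act \<sigma>'"
    for \<sigma> \<sigma>' :: "'b \<Rightarrow> 'a" and x
  proof -
    have "\<sigma>' x = \<sigma> x * \<sigma>' x" using that unfolding is_support_def by metis
    also have "\<dots> \<le> \<sigma> x * 1"
      using that(2) by (intro mult_mono_q) (auto simp: is_support_def base_def)
    finally show ?thesis by simp
  qed
  show ?thesis using *[OF assms] *[OF assms(2,1)] by (auto intro!: ext order.antisym)
qed

lemma is_support_supp:
  assumes "left_sheaf act" shows "is_support act (supp act)"
proof -
  have "\<exists>!\<sigma>. is_support act \<sigma>"
    using assms support_unique unfolding left_sheaf_def by blast
  then show ?thesis unfolding supp_def by (rule theI')
qed

lemma ex1_inner:
  fixes act :: "'q::inverse_quantal_frame \<Rightarrow> 'x::frame \<Rightarrow> 'x"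
  assumes "left_sheaf act" shows "\<exists>!p. is_inner act p"
proof -
  let ?S = "supp act" and ?G = "sections act"
  have "left_module act" and Gtop: "Sup ?G = top"
    using assms by (auto simp: left_sheaf_def left_locale_def)
  then have act1: "act 1 x = x" and actm: "act (a * b) x = act a (act b x)"
    and actS1: "act (Sup A) x = (SUP a\<in>A. act a x)"
    and actS2: "act a (Sup Y) = (SUP y\<in>Y. act a y)" for a b x A Y
    unfolding left_module_def by blast+
  have supp: "is_support act ?S" by (rule is_support_supp[OF assms])
  have S1: "?S x \<le> 1" and Sx: "act (?S x) x = x" for x
    using supp by (auto simp: is_support_def base_def)
  have Sm: "?S x \<le> ?S y" if "x \<le> y" for x y
    using supp that by (auto simp: is_support_def mono_def)
  have Se: "?S (act b x) = b * ?S x" if "b \<le> 1" for b x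
    using supp that by (auto simp: is_support_def base_def)
  have am: "act a x \<le> act b y" if "a \<le> b" "x \<le> y" for a b x y
  proof -
    have "act a x \<le> act (Sup {a, b}) x" unfolding actS1 by (rule SUP_upper) simp
    also have "\<dots> = act b x" using that by (simp add: sup.absorb2)
    also have "\<dots> \<le> act b (Sup {x, y})" unfolding actS2 by (rule SUP_upper) simp
    also have "\<dots> = act b y" using that by (simp add: sup.absorb2)
    finally show ?thesis .
  qed
  have S_Sup: "?S (Sup A) \<le> (SUP a\<in>A. ?S a)" for A
  proof -
    let ?b = "SUP a\<in>A. ?S a"
    have b1: "?b \<le> 1" using S1 by (simp add: SUP_least)
    have "Sup A \<le> act ?b (Sup A)"
    proof (rule Sup_least)
      fix a assume a: "a \<in> A"
      have "a = act (?S a) a" by (simp add: Sx)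
      also have "\<dots> \<le> act ?b (Sup A)" using a by (intro am SUP_upper Sup_upper)
      finally show "a \<le> act ?b (Sup A)" .
    qed
    then have "?S (Sup A) \<le> ?b * ?S (Sup A)" using Sm Se[OF b1] by metis
    also have "\<dots> \<le> ?b * 1" by (intro mult_mono_q order_refl S1)
    finally show ?thesis by simp
  qed
  have Gx: "act (?S x) s = x" if "s \<in> ?G" "x \<le> s" for s x
    using that by (auto simp: sections_def)
  have Gd: "t \<in> ?G" if "s \<in> ?G" "t \<le> s" for s t
  proof -
    have "act (?S x) t = x" if x: "x \<le> t" for x
    proof (rule order.antisym)
      show "act (?S x) t \<le> x"
        using am[OF order_refl \<open>t \<le> s\<close>, of "?S x"] Gx[OF \<open>s \<in> ?G\<close>, of x] x \<open>t \<le> s\<close> by auto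
      show "x \<le> act (?S x) t" using am[OF order_refl x, of "?S x"] Sx[of x] by simp
    qed
    then show ?thesis by (simp add: sections_def)
  qed
  define V where "V s t = {v \<in> partial_units. qsupp v \<le> ?S s \<and> qsupp (v\<^sup>\<star>) \<le> ?S t \<and> act v t \<le> s}"
    for s t
  define D where "D x = {s \<in> ?G. s \<le> x}" for x
  have D_Sup: "Sup (D x) = x" for x
  proof (rule order.antisym)
    show "Sup (D x) \<le> x" by (rule Sup_least) (simp add: D_def)
    have "x = inf x (Sup ?G)" by (simp add: Gtop)
    also have "\<dots> = (SUP s\<in>?G. inf x s)" by (rule inf_Sup_frame)
    also have "\<dots> \<le> Sup (D x)"
      by (rule SUP_least, rule Sup_upper) (auto simp: D_def intro: Gd)
    finally show "x \<le> Sup (D x)" .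
  qed
  define p where "p x y = (SUP s\<in>D x. SUP t\<in>D y. Sup (V s t))" for x y
  have Vm: "Sup (V s' t') \<le> Sup (V s t)"
    if "s \<in> ?G" "t \<in> ?G" "s' \<le> s" "t' \<le> t" for s t s' t'
  proof (rule Sup_subset_mono, rule subsetI)
    fix v assume v: "v \<in> V s' t'"
    have "act v t = act (v * qsupp (v\<^sup>\<star>)) t" by (simp add: mult_qsupp_invol)
    also have "\<dots> \<le> act v (act (?S t') t)" using v by (auto simp: actm V_def intro!: am)
    also have "\<dots> = act v t'" using that by (simp add: Gx)
    also have "\<dots> \<le> s" using v that by (auto simp: V_def)
    finally show "v \<in> V s t"
      using v Sm[OF \<open>s' \<le> s\<close>] Sm[OF \<open>t' \<le> t\<close>] by (auto simp: V_def)
  qed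
  have pG: "p s t = Sup (V s t)" if "s \<in> ?G" "t \<in> ?G" for s t
  proof (rule order.antisym)
    show "p s t \<le> Sup (V s t)" unfolding p_def
      using that by (intro SUP_least Vm) (auto simp: D_def)
    show "Sup (V s t) \<le> p s t" unfolding p_def
      using that by (intro SUP_upper2[of s] SUP_upper2[of t]) (auto simp: D_def)
  qed
  have up: "Sup (V s t) \<le> p x y" if "s \<in> D x" "t \<in> D y" for s t x y
    unfolding p_def using that by (intro SUP_upper2[of s] SUP_upper2[of t]) auto
  have pm: "p x y \<le> p x' y'" if "x \<le> x'" "y \<le> y'" for x y x' y'
    unfolding p_def[of x y] using that by (intro SUP_least up) (auto simp: D_def)
  have p1: "p (Sup A) y = (SUP x\<in>A. p x y)" for A y
  proof (rule order.antisym)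
    show "(SUP x\<in>A. p x y) \<le> p (Sup A) y" by (intro SUP_least pm Sup_upper) auto
    show "p (Sup A) y \<le> (SUP x\<in>A. p x y)"
      unfolding p_def[of "Sup A"]
    proof (intro SUP_least Sup_least)
      fix s t v assume s: "s \<in> D (Sup A)" and t: "t \<in> D y" and v: "v \<in> V s t"
      have "s = inf s (Sup A)" using s by (simp add: D_def inf.absorb1)
      then have s_eq: "s = (SUP x\<in>A. inf s x)" by (simp add: inf_Sup_frame)
      have "?S s \<le> (SUP x\<in>A. ?S (inf s x))"
        using S_Sup[of "(\<lambda>x. inf s x) ` A"] s_eq by (simp add: image_comp o_def)
      then have "?S s * v \<le> (SUP x\<in>A. ?S (inf s x)) * v" by (intro mult_mono_q order_refl)
      also have "\<dots> = (SUP x\<in>A. ?S (inf s x) * v)" by (simp add: Sup_mult image_comp o_def)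
      also have "\<dots> \<le> (SUP x\<in>A. p x y)"
      proof (rule SUP_mono)
        fix x assume x: "x \<in> A"
        have sG: "s \<in> ?G" using s by (simp add: D_def)
        let ?b = "?S (inf s x)"
        have 1: "qsupp (?b * v) \<le> ?b"
          using qsupp_mult_le[of ?b v] base_invol(2)[OF S1, of "inf s x"] by simp
        have 2: "qsupp ((?b * v)\<^sup>\<star>) \<le> ?S t"
          using qsupp_mult_le[of "v\<^sup>\<star>" "?b\<^sup>\<star>"] v by (auto simp: V_def invol_mult)
        have "act ?b (act v t) \<le> act ?b s" using v by (intro am order_refl) (simp add: V_def)
        also have "\<dots> = inf s x" using sG by (simp add: Gx)
        finally have "?b * v \<in> V (inf s x) t"
          using v 1 2 partial_units_base_mult(1)[OF _ S1] by (auto simp: V_def actm)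
        then have "?b * v \<le> p x y"
          using sG t by (intro order_trans[OF Sup_upper up]) (auto simp: D_def intro: Gd)
        then show "\<exists>m\<in>A. ?b * v \<le> p m y" using x by blast
      qed
      finally have "?S s * v \<le> (SUP x\<in>A. p x y)" .
      moreover have "v \<le> ?S s * v"
        using le_qsupp_mult[of v] v mult_mono_q[of "qsupp v" "?S s" v v]
        by (auto simp: V_def intro: order_trans)
      ultimately show "v \<le> (SUP x\<in>A. p x y)" by (rule order_trans[rotated])
    qed
  qed
  have p2: "p x (Sup B) = (SUP y\<in>B. p x y)" for x B
  proof (rule order.antisym)
    show "(SUP y\<in>B. p x y) \<le> p x (Sup B)" by (intro SUP_least pm Sup_upper) auto
    show "p x (Sup B) \<le> (SUP y\<in>B. p x y)"
      unfolding p_def[of x "Sup B"]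
    proof (intro SUP_least Sup_least)
      fix s t v assume s: "s \<in> D x" and t: "t \<in> D (Sup B)" and v: "v \<in> V s t"
      have "t = inf t (Sup B)" using t by (simp add: D_def inf.absorb1)
      then have t_eq: "t = (SUP y\<in>B. inf t y)" by (simp add: inf_Sup_frame)
      have "?S t \<le> (SUP y\<in>B. ?S (inf t y))"
        using S_Sup[of "(\<lambda>y. inf t y) ` B"] t_eq by (simp add: image_comp o_def)
      then have "v * ?S t \<le> v * (SUP y\<in>B. ?S (inf t y))" by (intro mult_mono_q order_refl)
      also have "\<dots> = (SUP y\<in>B. v * ?S (inf t y))" by (simp add: mult_Sup image_comp o_def)
      also have "\<dots> \<le> (SUP y\<in>B. p x y)"
      proof (rule SUP_mono)
        fix y assume y: "y \<in> B"
        have tG: "t \<in> ?G" using t by (simp add: D_def)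
        let ?c = "?S (inf t y)"
        have 1: "qsupp (v * ?c) \<le> ?S s"
          using qsupp_mult_le[of v ?c] v by (auto simp: V_def)
        have 2: "qsupp ((v * ?c)\<^sup>\<star>) \<le> ?c"
          using qsupp_mult_le[of ?c "v\<^sup>\<star>"] base_invol[OF S1, of "inf t y"]
          by (simp add: invol_mult)
        have "act v (act ?c (inf t y)) \<le> act v t" by (simp add: Sx am)
        also have "\<dots> \<le> s" using v by (simp add: V_def)
        finally have "v * ?c \<in> V s (inf t y)"
          using v 1 2 partial_units_base_mult(2)[OF _ S1] by (auto simp: V_def actm)
        then have "v * ?c \<le> p x y"
          using s tG by (intro order_trans[OF Sup_upper up]) (auto simp: D_def intro: Gd)
        then show "\<exists>m\<in>B. v * ?c \<le> p x m" using y by blast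
      qed
      finally have "v * ?S t \<le> (SUP y\<in>B. p x y)" .
      moreover have "v \<le> v * ?S t"
        using mult_qsupp_invol[of v] v mult_mono_q[of v v "qsupp (v\<^sup>\<star>)" "?S t"]
        by (auto simp: V_def)
      ultimately show "v \<le> (SUP y\<in>B. p x y)" by (rule order_trans[rotated])
    qed
  qed
  have "is_inner act p"
    unfolding is_inner_def using p1 p2 pG by (simp add: V_def)
  moreover have "q = p" if q: "is_inner act q" for q
  proof (intro ext)
    fix x y
    have "q x y = q (Sup (D x)) y" by (simp add: D_Sup)
    also have "\<dots> = (SUP s\<in>D x. q s y)" using q unfolding is_inner_def by blast
    also have "\<dots> = (SUP s\<in>D x. SUP t\<in>D y. q s t)"
    proof (rule SUP_cong[OF refl])
      fix s
      have "q s (Sup (D y)) = (SUP t\<in>D y. q s t)" using q unfolding is_inner_def by blast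
      then show "q s y = (SUP t\<in>D y. q s t)" by (simp add: D_Sup)
    qed
    also have "\<dots> = (SUP s\<in>D x. SUP t\<in>D y. Sup (V s t))"
      using q unfolding is_inner_def
      by (intro SUP_cong refl) (auto simp: D_def V_def)
    finally show "q x y = p x y" by (simp add: p_def)
  qed
  ultimately show ?thesis by blast
qed

lemma is_inner_inner: "left_sheaf act \<Longrightarrow> is_inner act (inner act)"
  unfolding inner_def by (rule theI'[OF ex1_inner])

end

theory Submission
  imports Defs
begin

text \<open>
  A right action is replaced throughout by the left action \<open>r \<cdot> x = xr\<^sup>\<star>\<close>, so that a bisheaf
  becomes a pair of commuting left sheaf structures \<open>L\<close> (of \<open>Q\<close>) and \<open>K\<close> (of \<open>R\<close>) on one locale,
  a situation that is symmetric in \<open>L\<close> and \<open>K\<close>. Write \<open>\<sigma>\<close>, \<open>\<langle>-,-\<rangle>\<close> and \<open>\<tau>\<close>, \<open>[-,-]\<close> for the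
  two supports and inner products. Sections are closed downwards, so the frame law makes the
  meets of left and right sections, which are bisections, join-dense. The two covering
  hypotheses say that every bisection is a principal section on both sides (whence there are
  enough principal sections) and that both supports take the top element to the unit. What
  remains of principality is that \<open>c \<mapsto> 1\<^sub>Xc\<close> hits every invariant element; this amounts to the
  orbit inequality \<open>1\<^sub>X\<tau>(x) \<le> 1\<^sub>Qx\<close>, which says that points in a common fibre of the
  right-hand projection lie in a common left orbit.

  If \<open>\<langle>s,t\<rangle>u = s[t,u]\<close> holds, then \<open>t\<tau>(u) \<le> t[u,u] = \<langle>t,u\<rangle>u \<le> 1\<^sub>Qu\<close> for bisections, and
  join-density gives the orbit inequality (lemma \<open>principal_bisheafI\<close>).

  Conversely, let both orbit inequalities hold (lemma \<open>principal_bisheaf_orbit\<close>). Then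
  \<open>\<sigma>(t)u \<le> t1\<^sub>R\<close>, and this improves to \<open>\<sigma>(t)u \<le> t[t,u]\<close> because a part of the section \<open>u\<close>
  below a translate of \<open>t\<close> is itself the translate of \<open>t\<close> by a partial unit contributing
  to the inner product (lemma \<open>le_inner_act\<close>). For a partial unit \<open>v\<close> contributing to \<open>\<langle>s,t\<rangle>\<close> this
  gives \<open>vu \<le> v\<sigma>(t)u \<le> vt[t,u] \<le> s[t,u]\<close>, hence \<open>\<langle>s,t\<rangle>u \<le> s[t,u]\<close>; the reverse inequality is
  the same statement with the two sides exchanged.
\<close>

section \<open>Partial units of an inverse quantal frame\<close>

lemma qsupp_partial_unit:
  fixes v :: "'q::inverse_quantal_frame"
  assumes "v \<in> partial_units"
  shows "qsupp v = v * v\<^sup>\<star>"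
proof (rule order.antisym[OF qsupp_le])
  have "v * v\<^sup>\<star> \<le> qsupp v * v * v\<^sup>\<star>"
    by (intro mult_mono_q le_qsupp_mult order_refl)
  also have "\<dots> \<le> qsupp v * 1"
    unfolding mult.assoc using assms by (intro mult_mono_q) (simp_all add: partial_units_def)
  finally show "v * v\<^sup>\<star> \<le> qsupp v" by simp
qed

lemma invol_partial_unit: "v \<in> partial_units \<Longrightarrow> v\<^sup>\<star> \<in> partial_units"
  by (simp add: partial_units_def invol_invol sup_commute)

lemma base_partial_unit:
  fixes b :: "'q::inverse_quantal_frame"
  assumes "b \<le> 1" shows "b \<in> partial_units"
  using mult_mono_q[OF assms assms] by (simp add: partial_units_def base_invol(1)[OF assms])

lemma partial_unit_regular:
  fixes v :: "'q::inverse_quantal_frame"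
  assumes "v \<in> partial_units"
  shows "v * v\<^sup>\<star> * v = v"
  using mult_qsupp_invol[of v] qsupp_partial_unit[OF invol_partial_unit[OF assms]]
  by (simp add: invol_invol mult.assoc)


section \<open>Sheaves over an inverse quantal frame\<close>

text \<open>A left sheaf, given by its action; the support and the inner product are determined by it.\<close>

locale quantale_sheaf =
  fixes act :: "'q::inverse_quantal_frame \<Rightarrow> 'x::frame \<Rightarrow> 'x"
  assumes sheaf: "left_sheaf act"
begin

lemma act_one: "act 1 x = x"
  and act_mult: "act (a * b) x = act a (act b x)"
  and act_Sup_left: "act (Sup A) x = (SUP a\<in>A. act a x)"
  and act_Sup_right: "act a (Sup Y) = (SUP y\<in>Y. act a y)"
  and act_base: "b \<le> 1 \<Longrightarrow> act b x = inf (act b top) x"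
  using sheaf unfolding left_sheaf_def left_locale_def left_module_def base_def by blast+

lemma Sup_sections: "Sup (sections act) = top"
  using sheaf by (simp add: left_sheaf_def)

lemma supp_le_one: "supp act x \<le> 1"
  and supp_mono: "x \<le> y \<Longrightarrow> supp act x \<le> supp act y"
  and supp_act_base: "b \<le> 1 \<Longrightarrow> supp act (act b x) = b * supp act x"
  and act_supp: "act (supp act x) x = x"
  using is_support_supp[OF sheaf] by (auto simp: is_support_def base_def mono_def)

lemma act_mono:
  assumes "a \<le> b" "x \<le> y" shows "act a x \<le> act b y"
proof -
  have "act a x \<le> act (Sup {a, b}) x" unfolding act_Sup_left by (rule SUP_upper) simp
  also have "\<dots> = act b x" using assms by (simp add: sup.absorb2)
  also have "\<dots> \<le> act b (Sup {x, y})" unfolding act_Sup_right by (rule SUP_upper) simp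
  also have "\<dots> = act b y" using assms by (simp add: sup.absorb2)
  finally show ?thesis .
qed

lemma act_base_le: "b \<le> 1 \<Longrightarrow> act b x \<le> x"
  using act_mono[of b 1 x x] by (simp add: act_one)

lemma le_act_top: "x \<le> act top x"
  using act_mono[of 1 top x x] by (simp add: act_one)

lemma act_top_top: "act top (act top x) = act top x"
  using mult_mono_q[of 1 top top "top :: 'q"]
  by (simp add: act_mult[symmetric] top.extremum_unique)

lemma supp_Sup_le: "supp act (Sup A) \<le> (SUP a\<in>A. supp act a)"
proof -
  let ?b = "SUP a\<in>A. supp act a"
  have b1: "?b \<le> 1" by (simp add: SUP_least supp_le_one)
  have "Sup A \<le> act ?b (Sup A)"
  proof (rule Sup_least)
    fix a assume "a \<in> A"
    then have "act (supp act a) a \<le> act ?b (Sup A)"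
      by (intro act_mono SUP_upper Sup_upper)
    then show "a \<le> act ?b (Sup A)" by (simp add: act_supp)
  qed
  then have "supp act (Sup A) \<le> ?b * supp act (Sup A)"
    using supp_mono supp_act_base[OF b1] by metis
  also have "\<dots> \<le> ?b * 1" by (intro mult_mono_q order_refl supp_le_one)
  finally show ?thesis by simp
qed

lemma supp_act_le: "supp act (act a x) \<le> qsupp (a * supp act x)"
proof -
  let ?a = "a * supp act x"
  have "act a x = act ?a x" by (simp add: act_mult act_supp)
  also have "\<dots> \<le> act (qsupp ?a * ?a) x" by (intro act_mono le_qsupp_mult order_refl)
  also have "\<dots> = act (qsupp ?a) (act a x)" by (simp add: act_mult act_supp)
  finally have "supp act (act a x) \<le> qsupp ?a * supp act (act a x)"
    using supp_mono supp_act_base[OF qsupp_le_one] by metis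
  also have "\<dots> \<le> qsupp ?a * 1" by (intro mult_mono_q order_refl supp_le_one)
  finally show ?thesis by simp
qed

lemma supp_act_le_conj: "supp act (act a x) \<le> a * supp act x * a\<^sup>\<star>"
proof -
  let ?b = "supp act x"
  have "qsupp (a * ?b) \<le> a * ?b * (a * ?b)\<^sup>\<star>" by (rule qsupp_le)
  also have "\<dots> = a * ?b * (?b * a\<^sup>\<star>)"
    by (simp add: invol_mult base_invol(1)[OF supp_le_one])
  also have "\<dots> \<le> a * ?b * (1 * a\<^sup>\<star>)" by (intro mult_mono_q order_refl supp_le_one)
  finally show ?thesis using supp_act_le[of a x] by simp
qed

lemma section_restrict: "s \<in> sections act \<Longrightarrow> x \<le> s \<Longrightarrow> act (supp act x) s = x"
  by (simp add: sections_def)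

lemma sectionI:
  assumes "\<And>x. x \<le> s \<Longrightarrow> act (supp act x) s \<le> x"
  shows "s \<in> sections act"
proof -
  have "x \<le> act (supp act x) s" if "x \<le> s" for x
    using act_mono[OF order_refl that, of "supp act x"] by (simp add: act_supp)
  then show ?thesis using assms by (auto simp: sections_def intro: order.antisym)
qed

lemma section_downward:
  assumes "s \<in> sections act" "t \<le> s" shows "t \<in> sections act"
proof (rule sectionI)
  fix x assume "x \<le> t"
  then show "act (supp act x) t \<le> x"
    using act_mono[OF order_refl assms(2), of "supp act x"] section_restrict[OF assms(1), of x]
      assms(2) by auto
qed

lemma partial_unit_act_section:
  assumes w: "w \<in> partial_units" and s: "s \<in> sections act"
  shows "act w s \<in> sections act"
proof (rule sectionI)
  fix x assume x: "x \<le> act w s"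
  have w1: "w * w\<^sup>\<star> \<le> 1" "w\<^sup>\<star> * w \<le> 1" using w by (auto simp: partial_units_def)
  let ?c = "supp act (act (w\<^sup>\<star>) x)"
  have "act (w\<^sup>\<star>) x \<le> act (w\<^sup>\<star>) (act w s)" by (intro act_mono order_refl x)
  also have "\<dots> \<le> s" using act_base_le[OF w1(2)] by (simp add: act_mult)
  finally have c: "act ?c s = act (w\<^sup>\<star>) x" by (rule section_restrict[OF s])
  have "act w s = act (w * w\<^sup>\<star>) (act w s)"
    using partial_unit_regular[OF w] by (metis act_mult)
  then have "x \<le> act (w * w\<^sup>\<star>) top"
    using x act_mono[OF order_refl top_greatest] by (metis order_trans)
  then have x_eq: "x = act w (act (w\<^sup>\<star>) x)"
    using act_base[OF w1(1), of x] by (simp add: act_mult inf.absorb2)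
  then have "supp act x \<le> w * ?c * w\<^sup>\<star>" using supp_act_le_conj by metis
  then have "act (supp act x) (act w s) \<le> act (w * ?c * w\<^sup>\<star>) (act w s)"
    by (intro act_mono order_refl)
  also have "\<dots> = act (w * ?c) (act (w\<^sup>\<star> * w) s)" by (simp add: act_mult)
  also have "\<dots> \<le> act (w * ?c) s" by (intro act_mono order_refl act_base_le w1)
  also have "\<dots> = x" using c x_eq by (simp add: act_mult)
  finally show "act (supp act x) (act w s) \<le> x" .
qed

text \<open>The partial units whose join is the inner product of two sections: those \<open>v\<close> that carry
  a part of \<open>t\<close> onto a part of \<open>s\<close> and whose domain and range are covered by these sections.\<close>

definition transporters :: "'x \<Rightarrow> 'x \<Rightarrow> 'q set"
  where "transporters s t = {v \<in> partial_units.
    qsupp v \<le> supp act s \<and> qsupp (v\<^sup>\<star>) \<le> supp act t \<and> act v t \<le> s}"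

lemma inner_sections:
  assumes "s \<in> sections act" "t \<in> sections act"
  shows "inner act s t = Sup (transporters s t)"
  using is_inner_inner[OF sheaf] assms by (simp add: is_inner_def transporters_def)

lemma invol_transporter:
  assumes s: "s \<in> sections act" and v: "v \<in> transporters s t"
  shows "v\<^sup>\<star> \<in> transporters t s"
proof -
  have pu: "v \<in> partial_units" and vs: "qsupp v \<le> supp act s"
    and vt: "v\<^sup>\<star> * v \<le> supp act t" and vts: "act v t \<le> s"
    using v qsupp_partial_unit[OF invol_partial_unit, of v]
    by (auto simp: transporters_def invol_invol)
  have v1: "v * v\<^sup>\<star> \<le> 1" "v\<^sup>\<star> * v \<le> 1" using pu by (auto simp: partial_units_def)
  let ?b = "supp act (act v t)"
  \<comment> \<open>The domain of \<open>v\<close> lies below \<open>\<sigma>(t)\<close>, so the support of \<open>vt\<close> is the whole range of \<open>v\<close>.\<close>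
  have vv: "v\<^sup>\<star> * v * (v\<^sup>\<star> * v) = v\<^sup>\<star> * v" "v * v\<^sup>\<star> * (v * v\<^sup>\<star>) = v * v\<^sup>\<star>"
    using partial_unit_regular[OF pu] by (metis mult.assoc)+
  have "v\<^sup>\<star> * v \<le> v\<^sup>\<star> * v * supp act t"
    using mult_mono_q[OF order_refl vt, of "v\<^sup>\<star> * v"] by (simp only: vv)
  also have "\<dots> = supp act (act (v\<^sup>\<star>) (act v t))"
    using supp_act_base[OF v1(2)] by (simp add: act_mult)
  also have "\<dots> \<le> v\<^sup>\<star> * ?b * v"
    using supp_act_le_conj[of "v\<^sup>\<star>"] by (simp add: invol_invol)
  finally have "v\<^sup>\<star> * v \<le> v\<^sup>\<star> * ?b * v" .
  then have "v * (v\<^sup>\<star> * v) * v\<^sup>\<star> \<le> v * (v\<^sup>\<star> * ?b * v) * v\<^sup>\<star>"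
    using mult_mono_q order_refl by metis
  also have "\<dots> = (v * v\<^sup>\<star>) * ?b * (v * v\<^sup>\<star>)" by (simp add: mult.assoc)
  also have "\<dots> \<le> 1 * ?b * 1" by (intro mult_mono_q order_refl v1)
  also have "v * (v\<^sup>\<star> * v) * v\<^sup>\<star> = v * v\<^sup>\<star>" using vv(2) by (simp add: mult.assoc)
  finally have range: "v * v\<^sup>\<star> \<le> ?b" by simp
  have "v\<^sup>\<star> = v\<^sup>\<star> * (v * v\<^sup>\<star>)"
    using partial_unit_regular[OF invol_partial_unit[OF pu]] by (simp add: invol_invol mult.assoc)
  then have "act (v\<^sup>\<star>) s = act (v\<^sup>\<star>) (act (v * v\<^sup>\<star>) s)" by (metis act_mult)
  also have "\<dots> \<le> act (v\<^sup>\<star>) (act ?b s)" by (intro act_mono order_refl range)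
  also have "\<dots> = act (v\<^sup>\<star> * v) t" by (simp add: section_restrict[OF s vts] act_mult)
  also have "\<dots> \<le> t" by (rule act_base_le[OF v1(2)])
  finally show ?thesis
    using v invol_partial_unit[OF pu] by (simp add: transporters_def invol_invol)
qed

lemma invol_inner:
  assumes "s \<in> sections act" "t \<in> sections act"
  shows "(inner act s t)\<^sup>\<star> = inner act t s"
proof -
  have le: "(inner act s t)\<^sup>\<star> \<le> inner act t s"
    if "s \<in> sections act" "t \<in> sections act" for s t
    unfolding inner_sections[OF that] inner_sections[OF that(2,1)] invol_Sup
    by (intro SUP_least Sup_upper invol_transporter that(1))
  show ?thesis
    using le[OF assms] invol_mono[OF le[OF assms(2,1)]] by (simp add: invol_invol order.antisym)
qed

lemma supp_le_inner:
  assumes "s \<in> sections act" shows "supp act s \<le> inner act s s"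
  unfolding inner_sections[OF assms assms]
  by (rule Sup_upper)
    (simp add: transporters_def base_partial_unit base_invol supp_le_one act_supp)

lemma principal_inner_le_supp:
  assumes s: "s \<in> sections act" and le: "inner act s s \<le> 1"
  shows "inner act s s \<le> supp act s"
  unfolding inner_sections[OF s s]
proof (rule Sup_least)
  fix v assume v: "v \<in> transporters s s"
  then have "v \<le> 1" using le Sup_upper[OF v] by (simp add: inner_sections[OF s s] order_trans)
  then show "v \<le> supp act s" using v base_invol(2)[of v] by (simp add: transporters_def)
qed

text \<open>A part of a section that lies in the orbit of another section is recovered from the latter
  by means of the inner product.\<close>

lemma le_inner_act:
  assumes t: "t \<in> sections act" and u: "u \<in> sections act"
    and xu: "x \<le> u" and xt: "x \<le> act top t"
  shows "x \<le> act (inner act u t) t"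
proof -
  have "act top t = (SUP w\<in>partial_units. act w t)"
    using Sup_partial_units by (metis act_Sup_left partial_units_def)
  then have "x = (SUP w\<in>partial_units. inf x (act w t))"
    using xt inf_Sup_frame[of x "(\<lambda>w. act w t) ` partial_units"]
    by (simp add: inf.absorb1 image_comp o_def)
  also have "\<dots> \<le> act (inner act u t) t"
  proof (rule SUP_least)
    fix w :: 'q assume w: "w \<in> partial_units"
    define y where "y = inf x (act w t)"
    \<comment> \<open>Cutting \<open>w\<close> down to the supports of \<open>y\<close> and \<open>t\<close> gives a partial unit carrying \<open>t\<close> onto \<open>y\<close>.\<close>
    define w' where "w' = supp act y * (w * supp act t)"
    have w't: "act w' t = y"
      using section_restrict[OF partial_unit_act_section[OF w t], of y]
      by (simp add: w'_def y_def act_mult act_supp)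
    have yu: "y \<le> u" using xu by (simp add: y_def le_infI1)
    have "qsupp w' \<le> supp act y"
      using qsupp_mult_le base_invol(2)[OF supp_le_one] by (metis w'_def)
    moreover have "qsupp (w'\<^sup>\<star>) \<le> supp act t"
      using qsupp_mult_le[of "supp act t" "w\<^sup>\<star> * supp act y"]
      by (simp add: w'_def invol_mult base_invol[OF supp_le_one] mult.assoc)
    moreover have "w' \<in> partial_units"
      unfolding w'_def by (intro partial_units_base_mult w supp_le_one)
    ultimately have "w' \<in> transporters u t"
      using w't yu supp_mono[OF yu] by (auto simp: transporters_def intro: order_trans)
    then have "w' \<le> inner act u t" by (simp add: inner_sections[OF u t] Sup_upper)
    then have "act w' t \<le> act (inner act u t) t" by (rule act_mono) simp
    then show "inf x (act w t) \<le> act (inner act u t) t" by (simp add: w't y_def)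
  qed
  finally show ?thesis .
qed

end


section \<open>Commuting sheaf structures\<close>

text \<open>A bisheaf, with the right action turned into a left action. The notion is symmetric in the
  two actions.\<close>

locale commuting_sheaves =
  L: quantale_sheaf L + K: quantale_sheaf K
  for L :: "'q::inverse_quantal_frame \<Rightarrow> 'x::frame \<Rightarrow> 'x"
    and K :: "'r::inverse_quantal_frame \<Rightarrow> 'x \<Rightarrow> 'x" +
  assumes commute: "K r (L a x) = L a (K r x)"
begin

lemma swap: "commuting_sheaves K L"
  by unfold_locales (simp add: commute)

text \<open>The bisections: the elements that are sections for both actions.\<close>

abbreviation common_sections :: "'x set"
  where "common_sections \<equiv> sections L \<inter> sections K"

lemma Sup_common_sections_below: "Sup {s \<in> common_sections. s \<le> x} = x"
proof (rule order.antisym)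
  show "Sup {s \<in> common_sections. s \<le> x} \<le> x" by (rule Sup_least) simp
  have "inf x s \<le> Sup {s \<in> common_sections. s \<le> x}" if s: "s \<in> sections L" for s
  proof -
    have "inf x s = (SUP t\<in>sections K. inf (inf x s) t)"
      using inf_Sup_frame[of "inf x s" "sections K"] by (simp add: K.Sup_sections)
    also have "\<dots> \<le> Sup {s \<in> common_sections. s \<le> x}"
    proof (intro SUP_least Sup_upper)
      fix t assume "t \<in> sections K"
      then show "inf (inf x s) t \<in> {s \<in> common_sections. s \<le> x}"
        using L.section_downward[OF s, of "inf (inf x s) t"]
          K.section_downward[of t "inf (inf x s) t"] by (simp add: le_infI1)
    qed
    finally show ?thesis .
  qed
  then have "(SUP s\<in>sections L. inf x s) \<le> Sup {s \<in> common_sections. s \<le> x}"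
    by (rule SUP_least)
  then show "x \<le> Sup {s \<in> common_sections. s \<le> x}"
    using inf_Sup_frame[of x "sections L"] by (simp add: L.Sup_sections)
qed

lemma Sup_common_sections: "Sup common_sections = top"
  using Sup_common_sections_below[of top] by (simp add: Int_def)

lemma invariant_act: "L top (K r top) = K r top"
  using L.le_act_top[of top] by (simp add: commute[symmetric] top.extremum_unique)

text \<open>If the invariants of \<open>L\<close> come from the base of \<open>K\<close>, then the fibres of the projection that
  belongs to \<open>K\<close> are contained in the orbits of \<open>L\<close>.\<close>

lemma orbit_of_invariants:
  assumes "invariants L \<subseteq> (\<lambda>c. K c top) ` base"
  shows "K (supp K x) top \<le> L top x"
proof -
  have "L top x \<in> invariants L" by (simp add: invariants_def L.act_top_top)
  then obtain c where c: "c \<le> 1" "L top x = K c top" using assms by (auto simp: base_def)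
  have "supp K x \<le> supp K (K c top)" using K.supp_mono[OF L.le_act_top] c(2) by metis
  also have "\<dots> = c * supp K top" by (rule K.supp_act_base[OF c(1)])
  also have "\<dots> \<le> c * 1" by (intro mult_mono_q order_refl K.supp_le_one)
  finally show ?thesis unfolding c(2) by (intro K.act_mono) simp_all
qed

text \<open>It suffices to verify the orbit inequality on bisections, because these are join-dense.\<close>

lemma orbit_of_sections:
  assumes "\<And>t u. t \<in> common_sections \<Longrightarrow> u \<in> common_sections \<Longrightarrow> K (supp K u) t \<le> L top u"
  shows "K (supp K x) top \<le> L top x"
proof -
  let ?D = "{u \<in> common_sections. u \<le> x}"
  have "K (supp K x) top \<le> K (SUP u\<in>?D. supp K u) (Sup common_sections)"
    using K.supp_Sup_le[of ?D] unfolding Sup_common_sections_below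
    by (intro K.act_mono) (simp_all add: Sup_common_sections)
  also have "\<dots> = (SUP t\<in>common_sections. SUP u\<in>?D. K (supp K u) t)"
    by (simp add: K.act_Sup_left K.act_Sup_right image_comp o_def)
  also have "\<dots> \<le> L top x"
  proof (intro SUP_least)
    fix t u assume t: "t \<in> common_sections" and u: "u \<in> ?D"
    have "K (supp K u) t \<le> L top u" using t u by (intro assms) simp_all
    also have "\<dots> \<le> L top x" using u by (intro L.act_mono) simp_all
    finally show "K (supp K u) t \<le> L top x" .
  qed
  finally show ?thesis .
qed

lemma base_act_reflects_order:
  assumes "supp K top = 1" "c \<le> 1" "d \<le> 1"
  shows "K c top \<le> K d top \<longleftrightarrow> c \<le> d"
  using K.supp_mono[of "K c top" "K d top"] K.act_mono[of c d top top] assms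
  by (auto simp: K.supp_act_base)

lemma base_act_bij_invariants:
  assumes one: "supp K top = 1" and orbit: "\<And>x. K (supp K x) top \<le> L top x"
  shows "bij_betw (\<lambda>c. K c top) base (invariants L)"
proof (rule bij_betw_imageI)
  show "inj_on (\<lambda>c. K c top) base"
  proof (rule inj_onI)
    fix c d assume "c \<in> base" "d \<in> base" and eq: "K c top = K d top"
    then have "c \<le> 1" "d \<le> 1" by (simp_all add: base_def)
    then show "c = d"
      using base_act_reflects_order[OF one, of c d] base_act_reflects_order[OF one, of d c]
      by (simp add: eq order.antisym)
  qed
  have "x \<in> (\<lambda>c. K c top) ` base" if "L top x = x" for x
  proof (rule image_eqI)
    show "supp K x \<in> base" by (simp add: base_def K.supp_le_one)
    show "x = K (supp K x) top"
      using orbit[of x] K.act_mono[OF order_refl top_greatest, of "supp K x" x] that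
      by (simp add: K.act_supp order.antisym)
  qed
  then show "(\<lambda>c. K c top) ` base = invariants L"
    by (auto simp: invariants_def invariant_act)
qed

lemma supp_top_of_inner_cover:
  assumes "(SUP s\<in>common_sections. inner K s s) = 1"
  shows "supp K top = 1"
proof (rule order.antisym[OF K.supp_le_one])
  have "inner K s s \<le> supp K top" if s: "s \<in> common_sections" for s
  proof -
    have "inner K s s \<le> 1" unfolding assms[symmetric] using s by (rule SUP_upper)
    then show ?thesis
      using s K.principal_inner_le_supp[of s] K.supp_mono[of s top] by (auto intro: order_trans)
  qed
  then show "1 \<le> supp K top" unfolding assms[symmetric] by (rule SUP_least)
qed

lemma inner_act_le:
  assumes orbit: "\<And>x. L (supp L x) top \<le> K top x"
    and s: "s \<in> common_sections" and t: "t \<in> common_sections" and u: "u \<in> common_sections"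
  shows "L (inner L s t) u \<le> K (inner K u t) s"
proof -
  let ?k = "inner K u t"
  have "L (supp L t) u \<le> L (supp L t) top" by (rule L.act_mono) simp_all
  then have "L (supp L t) u \<le> K top t" using orbit order_trans by blast
  then have *: "L (supp L t) u \<le> K ?k t"
    using t u L.act_base_le[OF L.supp_le_one] by (intro K.le_inner_act) auto
  have "L v u \<le> K ?k s" if v: "v \<in> L.transporters s t" for v
  proof -
    have "L v u = L v (L (qsupp (v\<^sup>\<star>)) u)" by (simp add: L.act_mult[symmetric] mult_qsupp_invol)
    also have "\<dots> \<le> L v (L (supp L t) u)"
      using v by (intro L.act_mono order_refl) (simp add: L.transporters_def)
    also have "\<dots> \<le> L v (K ?k t)" by (intro L.act_mono order_refl *)
    also have "\<dots> = K ?k (L v t)" by (simp add: commute)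
    also have "\<dots> \<le> K ?k s"
      using v by (intro K.act_mono order_refl) (simp add: L.transporters_def)
    finally show ?thesis .
  qed
  then show ?thesis using s t by (simp add: L.inner_sections L.act_Sup_left SUP_least)
qed

end


section \<open>Bisheaves\<close>

lemma left_dual_right_dual [simp]: "left_dual (right_dual lact) = lact"
  by (simp add: left_dual_def right_dual_def invol_invol)

lemma ract_eq_left_dual:
  fixes ract :: "'x \<Rightarrow> 'r::unital_involutive_quantale \<Rightarrow> 'x"
  shows "ract x r = left_dual ract (r\<^sup>\<star>) x"
  by (simp add: left_dual_def invol_invol)

lemma ract_base_eq_left_dual:
  fixes ract :: "'x \<Rightarrow> 'r::inverse_quantal_frame \<Rightarrow> 'x"
  shows "c \<le> 1 \<Longrightarrow> ract x c = left_dual ract c x"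
  by (simp add: left_dual_def base_invol)

lemma bisheaf_iff_commuting:
  "bisheaf lact ract \<longleftrightarrow> commuting_sheaves lact (left_dual ract)"
proof -
  have "(\<forall>a x r. ract (lact a x) r = lact a (ract x r)) \<longleftrightarrow>
    (\<forall>r a x. left_dual ract r (lact a x) = lact a (left_dual ract r x))"
    by (metis left_dual_def invol_invol)
  then show ?thesis
    by (simp add: bisheaf_def right_sheaf_def commuting_sheaves_def quantale_sheaf_def
        commuting_sheaves_axioms_def)
qed

lemma bisheaf_dual: "bisheaf lact ract \<Longrightarrow> bisheaf (left_dual ract) (right_dual lact)"
  by (simp add: bisheaf_iff_commuting commuting_sheaves.swap)

lemma bisections_eq:
  assumes "bisheaf lact ract"
  shows "bisections lact ract = sections lact \<inter> sections (left_dual ract)"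
proof -
  interpret commuting_sheaves lact "left_dual ract"
    using assms by (simp add: bisheaf_iff_commuting)
  show ?thesis
    by (auto simp: bisections_def right_sections_def sections_def right_supp_def
        ract_base_eq_left_dual[OF K.supp_le_one])
qed

lemma principal_bisheaf_orbit:
  assumes "principal_bisheaf lact ract"
  shows "left_dual ract (supp (left_dual ract) x) top \<le> lact top x"
proof -
  interpret commuting_sheaves lact "left_dual ract"
    using assms by (simp add: principal_bisheaf_def bisheaf_iff_commuting)
  have "invariants lact = (\<lambda>c. ract top c) ` base"
    using assms by (auto simp: principal_bisheaf_def bij_betw_def)
  also have "\<dots> = (\<lambda>c. left_dual ract c top) ` base"
    by (intro image_cong refl) (simp add: base_def ract_base_eq_left_dual)
  finally show ?thesis by (intro orbit_of_invariants) simp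
qed

lemma principal_bisheafI:
  fixes lact :: "'q::inverse_quantal_frame \<Rightarrow> 'x::frame \<Rightarrow> 'x"
    and ract :: "'x \<Rightarrow> 'r::inverse_quantal_frame \<Rightarrow> 'x"
  defines "K \<equiv> left_dual ract"
  assumes bisheaf: "bisheaf lact ract"
    and coverL: "(SUP s\<in>bisections lact ract. inner lact s s) = 1"
    and coverK: "(SUP s\<in>bisections lact ract. inner K s s) = 1"
    and orbit: "\<And>t u. t \<in> bisections lact ract \<Longrightarrow> u \<in> bisections lact ract \<Longrightarrow>
      K (supp K u) t \<le> lact top u"
  shows "principal_bisheaf lact ract"
proof -
  interpret commuting_sheaves lact K
    using bisheaf by (simp add: K_def bisheaf_iff_commuting)
  note [simp] = bisections_eq[OF bisheaf, folded K_def]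
  have "inner lact s s \<le> 1" if "s \<in> bisections lact ract" for s
    unfolding coverL[symmetric] using that by (rule SUP_upper)
  then have "bisections lact ract \<subseteq> principal_sections lact"
    by (auto simp: principal_sections_def)
  then have principal: "Sup (principal_sections lact) = top"
    using Sup_common_sections Sup_subset_mono[of common_sections "principal_sections lact"]
    by (simp add: top.extremum_unique)
  have one: "supp K top = 1" using coverK by (intro supp_top_of_inner_cover) simp
  have "K (supp K x) top \<le> lact top x" for x using orbit by (intro orbit_of_sections) auto
  then have "bij_betw (\<lambda>c. K c top) base (invariants lact)"
    by (rule base_act_bij_invariants[OF one])
  moreover have eq: "ract top c = K c top" if "c \<in> base" for c
    using that by (simp add: K_def base_def ract_base_eq_left_dual)
  ultimately have "bij_betw (\<lambda>c. ract top c) base (invariants lact)"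
    by (simp cong: bij_betw_cong)
  then show ?thesis
    using bisheaf principal base_act_reflects_order[OF one]
    by (simp add: principal_bisheaf_def eq) (simp add: base_def)
qed

theorem theorem5p18:
  fixes lact :: "'q::inverse_quantal_frame \<Rightarrow> 'x::frame \<Rightarrow> 'x"
    and ract :: "'x \<Rightarrow> 'r::inverse_quantal_frame \<Rightarrow> 'x"
  assumes "bisheaf lact ract"
    and "(SUP s\<in>bisections lact ract. inner lact s s) = 1"
    and "(SUP s\<in>bisections lact ract. right_inner ract s s) = 1"
  shows "biprincipal_bisheaf lact ract \<longleftrightarrow>
    (\<forall>s\<in>bisections lact ract. \<forall>t\<in>bisections lact ract. \<forall>u\<in>bisections lact ract.
       lact (inner lact s t) u = ract s (right_inner ract t u))"
proof -
  let ?B = "bisections lact ract"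
  define K where "K = left_dual ract"
  interpret commuting_sheaves lact K
    using assms(1) by (simp add: K_def bisheaf_iff_commuting)
  have B: "?B = sections lact \<inter> sections K"
    by (simp add: K_def bisections_eq[OF assms(1)])
  have B': "bisections K (right_dual lact) = ?B"
    using bisections_eq[OF bisheaf_dual[OF assms(1)]] B by (auto simp: K_def)
  have right: "right_inner ract = inner K" by (simp add: right_inner_def K_def)
  have ract: "ract x r = K (r\<^sup>\<star>) x" for x r by (simp add: K_def ract_eq_left_dual)
  show ?thesis
  proof (intro iffI ballI)
    assume "biprincipal_bisheaf lact ract"
    then have orbits: "K (supp K x) top \<le> lact top x" "lact (supp lact x) top \<le> K top x" for x
      using principal_bisheaf_orbit[of lact ract] principal_bisheaf_orbit[of K "right_dual lact"]
      by (simp_all add: biprincipal_bisheaf_def K_def)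
    fix s t u assume stu: "s \<in> ?B" "t \<in> ?B" "u \<in> ?B"
    have "lact (inner lact s t) u \<le> K (inner K u t) s"
      using stu by (intro inner_act_le orbits) (auto simp: B)
    moreover have "K (inner K u t) s \<le> lact (inner lact s t) u"
      using stu by (intro commuting_sheaves.inner_act_le[OF swap] orbits) (auto simp: B)
    moreover have "K (inner K u t) s = ract s (right_inner ract t u)"
      using stu by (simp add: B right ract K.invol_inner)
    ultimately show "lact (inner lact s t) u = ract s (right_inner ract t u)"
      by (simp add: order.antisym)
  next
    assume "\<forall>s\<in>?B. \<forall>t\<in>?B. \<forall>u\<in>?B. lact (inner lact s t) u = ract s (right_inner ract t u)"
    then have eq: "lact (inner lact s t) u = K ((inner K t u)\<^sup>\<star>) s"
      if "s \<in> ?B" "t \<in> ?B" "u \<in> ?B" for s t u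
      using that by (simp add: right ract)
    have "K (supp K u) t \<le> lact top u" if tu: "t \<in> ?B" "u \<in> ?B" for t u
    proof -
      have "supp K u \<le> (inner K u u)\<^sup>\<star>"
        using invol_mono[OF K.supp_le_inner, of u] tu by (simp add: B base_invol K.supp_le_one)
      then have "K (supp K u) t \<le> lact (inner lact t u) u"
        using eq[of t u u] tu by (simp add: K.act_mono)
      also have "\<dots> \<le> lact top u" by (rule L.act_mono) simp_all
      finally show ?thesis .
    qed
    then have "principal_bisheaf lact ract"
      using assms by (intro principal_bisheafI) (simp_all add: right_inner_def K_def)
    moreover have "lact (supp lact u) t \<le> K top u" if tu: "t \<in> ?B" "u \<in> ?B" for t u
    proof -
      have "lact (supp lact u) t \<le> lact (inner lact u u) t"
        using tu by (intro L.act_mono order_refl L.supp_le_inner) (simp add: B)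
      also have "\<dots> \<le> K top u" unfolding eq[OF tu(2,2,1)] by (rule K.act_mono) simp_all
      finally show ?thesis .
    qed
    then have "principal_bisheaf K (right_dual lact)"
      using assms bisheaf_dual[OF assms(1)]
      by (intro principal_bisheafI) (simp_all add: right_inner_def K_def[symmetric] B')
    ultimately show "biprincipal_bisheaf lact ract"
      by (simp add: biprincipal_bisheaf_def K_def)
  qed
qed

end
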